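(* Let $N\ge 1$. There exists a differentiable, locally Lipschitz function $f:\mathbb{R}^N\to\mathbb{R}$ such that for every compact connected subset $K$ of $\mathbb{R}^N$ with nonempty interior there exists $x\in\mathbb{R}^N$ such that $\partial_L f(x)=K$. Moreover, for any given $\varepsilon>0$, the function $f$ can be taken to satisfy in addition $\|f\|_\infty:=\sup_{x\in\mathbb{R}^N}|f(x)|<\varepsilon$.
   Context: $\mathbb{R}^N$ is the Euclidean space; "differentiable" means differentiable at every point. For an everywhere differentiable locally Lipschitz function $f:\mathbb{R}^N\to\mathbb{R}$, the limiting subdifferential of $f$ at $x$ is the set $$\partial_L f(x)=\Big\{p\in\mathbb{R}^N:\ \text{there is a sequence } x_n\to x \text{ with } \nabla f(x_n)\to p\Big\}.$$ *)

theory Defs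
  imports "HOL-Analysis.Analysis"
begin

text \<open>
  The library's \<^const>\<open>local_lipschitz\<close> is about families of functions; the following is the
  usual notion for a single function on the whole space.
\<close>

definition locally_lipschitz :: "('a::metric_space \<Rightarrow> 'b::metric_space) \<Rightarrow> bool"
  where "locally_lipschitz f \<longleftrightarrow> (\<forall>x. \<exists>u>0. \<exists>L. L-lipschitz_on (cball x u) f)"

lemma locally_lipschitz_iff_local_lipschitz:
  "locally_lipschitz f \<longleftrightarrow> local_lipschitz {t::'t::metric_space} UNIV (\<lambda>_. f)"
  by (simp add: locally_lipschitz_def local_lipschitz_def) (meson less_imp_le)

text \<open>
  The gradient at each \<open>X n\<close> is given by the relation \<^const>\<open>gderiv\<close>, so only points of
  differentiability of \<open>f\<close> are admitted; this is no restriction when \<open>f\<close> is everywhere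
  differentiable. The points \<open>X n\<close> need not differ from \<open>x\<close>.
\<close>

definition limiting_subdifferential :: "('a::real_inner \<Rightarrow> real) \<Rightarrow> 'a \<Rightarrow> 'a set"
  where "limiting_subdifferential f x =
    {p. \<exists>X G. X \<longlonglongrightarrow> x \<and> (\<forall>n::nat. GDERIV f (X n) :> G n) \<and> G \<longlonglongrightarrow> p}"

end

theory Submission
  imports Defs
begin

text \<open>
  Differentiable bumps of arbitrarily small size can have their gradients in any prescribed connected open
  set \<open>U\<close> around \<open>0\<close> while attaining a prescribed value in \<open>U\<close>: walk from \<open>0\<close> to that value inside
  \<open>U\<close>, correcting the gradient a little on a smaller and smaller ball. Place one such bump in each gap
  of a Cantor set on a line, that is, at each node of the binary tree. Along a branch,
  the bits tell which members of a countable family of closed sets are disjoint from \<open>K\<close>, so a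
  continuum \<open>K\<close> containing \<open>0\<close> determines a branch, and the gradients allowed at a node form the
  component of \<open>0\<close> in a ball minus the sets excluded so far. These components shrink to \<open>K\<close> along the branch of \<open>K\<close>, so
  \<open>K\<close> is the set of limiting gradients at the corresponding point of the Cantor set. If the bumps are
  small compared with the squared distance to the Cantor set, the sum is differentiable there, with
  gradient \<open>0\<close>. Finally, as \<open>K\<close> has interior points, it contains a point \<open>q\<close> of a countable dense
  set; adding a function with gradient \<open>q\<close> near the Cantor set reduces to the case \<open>0 \<in> K\<close>, and the
  countably many choices of \<open>q\<close> and of the radius of the ball are realised in disjoint unit balls.
\<close>

section \<open>Gradients and their limits without sequences\<close>

text \<open>
  As with \<^const>\<open>limiting_subdifferential\<close>, the points at which the gradient is taken may equal \<open>x\<close>.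
\<close>

definition gradient_limits :: "('a::metric_space \<Rightarrow> 'b::metric_space) \<Rightarrow> 'a \<Rightarrow> 'b set"
  where "gradient_limits D x = {p. \<forall>e>0. \<exists>y. dist y x < e \<and> dist (D y) p < e}"

lemma GDERIV_unique:
  assumes "GDERIV f x :> a" "GDERIV f x :> b"
  shows "a = b"
proof -
  have "(\<lambda>h. inner h a) = (\<lambda>h. inner h b)"
    using assms has_derivative_unique unfolding gderiv_def by blast
  then have "inner (a - b) a = inner (a - b) b"
    by meson
  then have "inner (a - b) (a - b) = 0"
    by (simp add: inner_diff_right)
  then show ?thesis by simp
qed

text \<open>A sequence supplies points for each \<open>e\<close>, and points chosen for
  \<open>e = inverse (Suc n)\<close> form a sequence. Since gradients are unique, \<open>D\<close>
  can stand for them.\<close>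

lemma limiting_subdifferential_eq_gradient_limits:
  assumes "\<And>x. GDERIV f x :> D x"
  shows "limiting_subdifferential f x = gradient_limits D x"
proof (intro equalityI subsetI)
  fix p assume "p \<in> limiting_subdifferential f x"
  then obtain X G where X: "X \<longlonglongrightarrow> x" and G: "\<And>n::nat. GDERIV f (X n) :> G n" "G \<longlonglongrightarrow> p"
    unfolding limiting_subdifferential_def by auto
  have "G = (\<lambda>n. D (X n))"
    using G(1) assms GDERIV_unique by blast
  then have "(\<lambda>n. D (X n)) \<longlonglongrightarrow> p" using G by simp
  then have "\<exists>y. dist y x < e \<and> dist (D y) p < e" if "e > 0" for e
    using eventually_conj[OF tendstoD[OF X that] tendstoD[OF _ that]]
    by (metis (mono_tags, lifting) eventually_happens sequentially_bot)
  then show "p \<in> gradient_limits D x"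
    by (simp add: gradient_limits_def)
next
  fix p assume "p \<in> gradient_limits D x"
  then have "\<forall>n. \<exists>y. dist y x < inverse (Suc n) \<and> dist (D y) p < inverse (Suc n)"
    by (simp add: gradient_limits_def)
  then obtain X where X: "\<And>n. dist (X n) x < inverse (Suc n)" "\<And>n. dist (D (X n)) p < inverse (Suc n)"
    by metis
  have "(\<lambda>n. dist (X n) x) \<longlonglongrightarrow> 0" "(\<lambda>n. dist (D (X n)) p) \<longlonglongrightarrow> 0"
    by (rule tendsto_sandwich[OF _ _ tendsto_const LIMSEQ_inverse_real_of_nat];
        use X in \<open>auto intro!: always_eventually less_imp_le\<close>)+
  then have X: "X \<longlonglongrightarrow> x" "(\<lambda>n. D (X n)) \<longlonglongrightarrow> p"
    by (simp_all only: tendsto_dist_iff[symmetric])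
  define G where "G = (\<lambda>n. D (X n))"
  have "X \<longlonglongrightarrow> x \<and> (\<forall>n. GDERIV f (X n) :> G n) \<and> G \<longlonglongrightarrow> p"
    using X assms by (simp add: G_def)
  then show "p \<in> limiting_subdifferential f x"
    unfolding limiting_subdifferential_def by blast
qed

text \<open>Gradient limits are local, and a similarity maps small balls to small balls. The form of
  \<open>E\<close> is that of a rescaled copy of \<open>D\<close> added where another gradient is
  constantly \<open>q\<close>.\<close>

lemma gradient_limits_affine:
  fixes D :: "'a::real_normed_vector \<Rightarrow> 'b::real_normed_vector"
  assumes t: "t > 0" and u: "u > 0"
    and E: "\<And>y. dist y (c + t *\<^sub>R x) < u \<Longrightarrow> E y = q + D ((y - c) /\<^sub>R t)"
  shows "gradient_limits E (c + t *\<^sub>R x) = (+) q ` gradient_limits D x"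
proof -
  have sub: "dist (c + t *\<^sub>R y) (c + t *\<^sub>R x) = t * dist y x" for y
    using t by (simp add: dist_norm flip: scaleR_diff_right)
  have E': "E (c + t *\<^sub>R y) = q + D y" if "t * dist y x < u" for y
    using E[of "c + t *\<^sub>R y"] that t sub by simp
  have "p + q \<in> gradient_limits E (c + t *\<^sub>R x) \<longleftrightarrow> p \<in> gradient_limits D x" for p
  proof
    assume L: "p + q \<in> gradient_limits E (c + t *\<^sub>R x)"
    show "p \<in> gradient_limits D x"
      unfolding gradient_limits_def
    proof safe
      fix e :: real assume "e > 0"
      then have "min u (min e (t * e)) > 0" using t u by simp
      then obtain z where z: "dist z (c + t *\<^sub>R x) < min u (min e (t * e))"
          "dist (E z) (p + q) < min u (min e (t * e))"
        using L unfolding gradient_limits_def by blast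
      define y where "y = (z - c) /\<^sub>R t"
      have zy: "z = c + t *\<^sub>R y" using t by (simp add: y_def)
      have "dist y x < e" "dist (D y) p < e"
        using z t E'[of y] unfolding zy sub by (auto simp: dist_norm algebra_simps)
      then show "\<exists>y. dist y x < e \<and> dist (D y) p < e" by blast
    qed
  next
    assume L: "p \<in> gradient_limits D x"
    show "p + q \<in> gradient_limits E (c + t *\<^sub>R x)"
      unfolding gradient_limits_def
    proof safe
      fix e :: real assume "e > 0"
      then have "min (u / t) (min e (e / t)) > 0" using t u by simp
      then obtain y where y: "dist y x < min (u / t) (min e (e / t))"
          "dist (D y) p < min (u / t) (min e (e / t))"
        using L unfolding gradient_limits_def by blast
      then have "t * dist y x < u" "t * dist y x < e"
        using t by (auto simp: field_simps)
      then have "dist (c + t *\<^sub>R y) (c + t *\<^sub>R x) < e \<and> dist (E (c + t *\<^sub>R y)) (p + q) < e"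
        using E'[of y] y sub by (auto simp: dist_norm algebra_simps)
      then show "\<exists>y. dist y (c + t *\<^sub>R x) < e \<and> dist (E y) (p + q) < e" by blast
    qed
  qed
  then have "p \<in> gradient_limits E (c + t *\<^sub>R x) \<longleftrightarrow> p - q \<in> gradient_limits D x" for p
    by (metis diff_add_cancel)
  then show ?thesis
    by (force simp: image_iff)
qed

section \<open>Differentiable bumps with prescribed gradients\<close>

definition bump :: "('a::real_inner \<Rightarrow> real) \<Rightarrow> ('a \<Rightarrow> 'a) \<Rightarrow> 'a \<Rightarrow> real \<Rightarrow> bool"
  where "bump f D c r \<longleftrightarrow>
    (\<forall>x. GDERIV f x :> D x) \<and> (\<forall>x. r \<le> dist x c \<longrightarrow> f x = 0 \<and> D x = 0)"

lemma bump_mono: "bump f D c r \<Longrightarrow> r \<le> r' \<Longrightarrow> bump f D c r'"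
  by (auto simp: bump_def)

text \<open>The height factor \<open>t\<close> cancels the \<open>1 / t\<close> from the chain rule,
  so functions can be made small in this way without changing the set of their gradients.\<close>

lemma GDERIV_rescale:
  assumes "GDERIV f ((x - c) /\<^sub>R t) :> d" "t \<noteq> 0"
  shows "GDERIV (\<lambda>x. t * f ((x - c) /\<^sub>R t)) x :> d"
proof -
  have "((\<lambda>x. (x - c) /\<^sub>R t) has_derivative (\<lambda>h. h /\<^sub>R t)) (at x)"
    by (auto intro!: derivative_eq_intros)
  from has_derivative_compose[OF this assms(1)[unfolded gderiv_def]]
  have "((\<lambda>x. t * f ((x - c) /\<^sub>R t)) has_derivative (\<lambda>h. t * inner (h /\<^sub>R t) d)) (at x)"
    by (rule has_derivative_mult_right)
  moreover have "t * inner (h /\<^sub>R t) d = inner h d" for h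
    using assms(2) by simp
  ultimately show ?thesis
    by (simp only: gderiv_def)
qed

lemma bump_rescale:
  assumes "bump f D 0 r" "t > 0"
  shows "bump (\<lambda>x. t * f ((x - c) /\<^sub>R t)) (\<lambda>x. D ((x - c) /\<^sub>R t)) c (t * r)"
proof -
  have "r \<le> norm ((x - c) /\<^sub>R t)" if "t * r \<le> dist x c" for x
    unfolding norm_scaleR using assms(2) that by (simp add: dist_norm field_simps)
  then show ?thesis
    using assms by (auto simp: bump_def intro!: GDERIV_rescale simp del: scaleR_diff_right)
qed

lemma bump_add:
  assumes "bump f D c r" "bump g E c' r'" "dist c' c + r' \<le> r"
  shows "bump (\<lambda>x. f x + g x) (\<lambda>x. D x + E x) c r"
proof -
  have "r' \<le> dist x c'" if "r \<le> dist x c" for x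
    using assms(3) that dist_triangle[of x c c'] by linarith
  then show ?thesis
    using assms by (auto simp: bump_def GDERIV_add)
qed

lemma bump_bounded:
  fixes f :: "'a::euclidean_space \<Rightarrow> real"
  assumes "bump f D c r"
  obtains B where "B > 0" "\<And>x. \<bar>f x\<bar> \<le> B"
proof -
  have "continuous_on (cball c r) f"
    using assms unfolding bump_def gderiv_def
    by (meson differentiable_def differentiable_imp_continuous_within continuous_at_imp_continuous_on)
  then have "bounded (f ` cball c r)"
    by (intro compact_imp_bounded compact_continuous_image) auto
  then obtain B where B: "B > 0" "\<And>x. x \<in> cball c r \<Longrightarrow> \<bar>f x\<bar> \<le> B"
    unfolding bounded_pos by auto
  have "\<bar>f x\<bar> \<le> B" for x
    using B assms unfolding bump_def by (cases "dist x c \<le> r") (auto simp: dist_commute)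
  then show ?thesis using B that by blast
qed

lemma DERIV_square_pos_part: "((\<lambda>t::real. (max 0 t)\<^sup>2) has_real_derivative 2 * max 0 t) (at t)"
proof -
  consider "t > 0" | "t < 0" | "t = 0" by linarith
  then show ?thesis
  proof cases
    case 1
    have "((\<lambda>t. t\<^sup>2) has_real_derivative 2 * max 0 t) (at t)"
      using 1 by (auto intro!: derivative_eq_intros)
    then show ?thesis
      by (rule has_field_derivative_transform_within_open[of _ _ _ "{0<..}"]) (use 1 in auto)
  next
    case 2
    have "((\<lambda>t. 0) has_real_derivative 2 * max 0 t) (at t)"
      using 2 by auto
    then show ?thesis
      by (rule has_field_derivative_transform_within_open[of _ _ _ "{..<0}"]) (use 2 in auto)
  next
    case 3
    have "((\<lambda>h::real. max 0 h) \<longlongrightarrow> max 0 0) (at 0)"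
      by (intro tendsto_intros)
    moreover have "(max 0 h)\<^sup>2 / h = max 0 h" for h :: real
      by (auto simp: max_def power2_eq_square)
    ultimately show ?thesis
      using 3 by (simp add: DERIV_def)
  qed
qed

text \<open>A radial cutoff times a linear form. The bound on the gradient survives
  \<open>bump_rescale\<close>, so changing a gradient by \<open>v\<close> on a ball costs the same
  however small the ball is.\<close>

lemma cutoff_linear:
  fixes v :: "'a::real_inner"
  obtains f D where "bump f D 0 2" "\<And>x. norm x \<le> 1 \<Longrightarrow> D x = v" "\<And>x. norm (D x) \<le> 20 * norm v"
proof -
  define g where "g = (\<lambda>t::real. (max 0 t)\<^sup>2)"
  define g' where "g' = (\<lambda>t::real. 2 * max 0 t)"
  define s where "s = (\<lambda>x::'a. inner x x - 1)"
  \<comment> \<open>\<open>g (s x)\<close> is \<open>0\<close> on the unit ball and at least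
    \<open>1\<close> as soon as \<open>inner x x\<close> is at least \<open>2\<close>, so
    \<open>h\<close> falls from \<open>1\<close> to \<open>0\<close> in between.\<close>
  define h where "h = (\<lambda>x. g (1 - g (s x)))"
  define h' where "h' = (\<lambda>x. (g' (1 - g (s x)) * (- g' (s x)) * 2) *\<^sub>R x)"
  define f where "f = (\<lambda>x. h x * inner x v)"
  define D where "D = (\<lambda>x. h x *\<^sub>R v + inner x v *\<^sub>R h' x)"
  have g: "(g has_real_derivative g' t) (at t)" for t
    unfolding g_def g'_def by (rule DERIV_square_pos_part)
  have s: "GDERIV s x :> 2 *\<^sub>R x" for x
    unfolding gderiv_def s_def
    by (auto intro!: derivative_eq_intros simp: inner_commute fun_eq_iff)
  have G: "((\<lambda>t. g (1 - g t)) has_real_derivative g' (1 - g t) * (- g' t)) (at t)" for t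
    by (rule DERIV_chain2[OF g]) (auto intro!: derivative_eq_intros g)
  have h: "GDERIV h x :> h' x" for x
    using GDERIV_DERIV_compose[OF s G] by (simp add: h_def h'_def)
  have v: "GDERIV (\<lambda>x. inner x v) x :> v" for x
    unfolding gderiv_def by (auto intro!: derivative_eq_intros)
  have D: "GDERIV f x :> D x" for x
    using GDERIV_mult[OF h v] by (simp add: f_def D_def)
  have out: "h x = 0" "h' x = 0" if "s x \<ge> 1" for x
  proof -
    have "1 \<le> g (s x)" using that by (simp add: g_def one_le_power)
    then show "h x = 0" "h' x = 0" by (simp_all add: h_def h'_def g'_def g_def)
  qed
  have "s x \<ge> 1" if "norm x \<ge> 2" for x
    using power_mono[OF that, of 2] by (simp add: s_def dot_square_norm)
  then have "bump f D 0 2"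
    unfolding bump_def using D out by (simp add: f_def D_def)
  moreover have "D x = v" if "norm x \<le> 1" for x
  proof -
    have "s x \<le> 0" using power_mono[OF that, of 2] by (simp add: s_def dot_square_norm)
    then show ?thesis by (simp add: D_def h_def h'_def g'_def g_def)
  qed
  moreover have "norm (D x) \<le> 20 * norm v" for x
  proof (cases "s x \<ge> 1")
    case True
    then show ?thesis using out by (simp add: D_def)
  next
    case False
    then have x: "(norm x)\<^sup>2 \<le> 2" by (simp add: s_def dot_square_norm)
    have h1: "\<bar>h x\<bar> \<le> 1"
      by (simp add: h_def g_def power_le_one abs_square_le_1)
    have "\<bar>g' (1 - g (s x))\<bar> \<le> 2" "\<bar>g' (s x)\<bar> \<le> 2"
      using False by (auto simp: g'_def g_def)
    then have "\<bar>g' (1 - g (s x)) * (- g' (s x)) * 2\<bar> \<le> 8"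
      using mult_mono[of "\<bar>g' (1 - g (s x))\<bar>" 2 "\<bar>g' (s x)\<bar>" 2]
      by (simp add: abs_mult mult.commute)
    then have h2: "norm (h' x) \<le> 8 * norm x"
      by (simp add: h'_def mult_right_mono)
    have "norm (D x) \<le> \<bar>h x\<bar> * norm v + \<bar>inner x v\<bar> * norm (h' x)"
      unfolding D_def by (metis norm_scaleR norm_triangle_ineq)
    also have "\<dots> \<le> 1 * norm v + (norm x * norm v) * (8 * norm x)"
      by (intro add_mono mult_mono h1 h2 Cauchy_Schwarz_ineq2) auto
    also have "\<dots> = (1 + 8 * (norm x)\<^sup>2) * norm v"
      by (simp add: power2_eq_square algebra_simps)
    \<comment> \<open>The factor is at most \<open>17\<close>, as the squared norm is at most
      \<open>2\<close>.\<close>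
    also have "\<dots> \<le> 20 * norm v"
      using x by (intro mult_right_mono) auto
    finally show ?thesis .
  qed
  ultimately show ?thesis using that by blast
qed

text \<open>Where the gradient is constantly \<open>d\<close>, adding a small cutoff linear form
  changes it to a nearby \<open>d'\<close>; connectedness of \<open>U\<close> carries this from
  \<open>0\<close> to every target. The ball of constant gradient is kept in the claim because the
  next correction takes place there.\<close>

lemma bump_in_connected_open:
  fixes U :: "'a::real_inner set"
  assumes "open U" "connected U" "0 \<in> U" "d \<in> U"
  obtains f D c r where "bump f D 0 1" "range D \<subseteq> U" "r > 0" "norm c + r \<le> 1"
    "\<And>x. x \<in> ball c r \<Longrightarrow> D x = d"
proof -
  define P where "P = (\<lambda>d. \<exists>f D c r. bump f D (0::'a) 1 \<and> range D \<subseteq> U \<and> r > 0 \<and> norm c + r \<le> 1 \<and>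
    (\<forall>x. dist x c < r \<longrightarrow> D x = d))"
  \<comment> \<open>The factor \<open>20\<close> comes from \<open>cutoff_linear\<close>: all
    corrected gradients stay in this ball around \<open>d\<close>.\<close>
  have step: "P d'" if P: "P d" and ball: "cball d (20 * dist d' d) \<subseteq> U" for d d'
  proof -
    from P obtain f D c r where f: "bump f D 0 1" "range D \<subseteq> U" and r: "r > 0" "norm c + r \<le> 1"
      and d: "\<And>x. dist x c < r \<Longrightarrow> D x = d"
      unfolding P_def by auto
    obtain g E where g: "bump g E 0 2" "\<And>x. norm x \<le> 1 \<Longrightarrow> E x = d' - d"
      "\<And>x. norm (E x) \<le> 20 * norm (d' - d)"
      using cutoff_linear by blast
    define E' where "E' = (\<lambda>x. E ((x - c) /\<^sub>R (r / 2)))"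
    have bg: "bump (\<lambda>x. (r / 2) * g ((x - c) /\<^sub>R (r / 2))) E' c r"
      using bump_rescale[OF g(1), of "r / 2" c] r by (simp add: E'_def)
    then have b: "bump (\<lambda>x. f x + (r / 2) * g ((x - c) /\<^sub>R (r / 2))) (\<lambda>x. D x + E' x) 0 1"
      by (rule bump_add[OF f(1)]) (use r in simp)
    have "D x + E' x \<in> U" for x
    proof (cases "dist x c < r")
      case True
      have "norm (E' x) \<le> 20 * dist d' d" unfolding E'_def dist_norm by (rule g)
      then have "d + E' x \<in> cball d (20 * dist d' d)" by (simp add: dist_norm)
      then show ?thesis using d[OF True] ball by auto
    next
      case False
      then have "E' x = 0" using bg by (simp add: bump_def)
      then show ?thesis using f by auto
    qed
    moreover have "D x + E' x = d'" if "dist x c < r / 2" for x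
    proof -
      have "norm ((x - c) /\<^sub>R (r / 2)) \<le> 1"
        unfolding norm_scaleR using that r by (simp add: dist_norm field_simps)
      then have "E' x = d' - d" unfolding E'_def by (rule g)
      then show ?thesis using d[of x] that r by simp
    qed
    ultimately show ?thesis
      unfolding P_def using b r
      by (intro exI[of _ "\<lambda>x. f x + (r / 2) * g ((x - c) /\<^sub>R (r / 2))"] exI[of _ "\<lambda>x. D x + E' x"]
          exI[of _ c] exI[of _ "r / 2"]) auto
  qed
  have "P 0"
    unfolding P_def
    by (rule exI[of _ "\<lambda>_. 0"], rule exI[of _ "\<lambda>_. 0"], rule exI[of _ 0], rule exI[of _ 1])
      (use assms in \<open>auto simp: bump_def GDERIV_const\<close>)
  then have "P d"
  proof (rule connected_induction_simple[OF assms(2,3,4)])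
    fix a assume "a \<in> U"
    then obtain e where e: "e > 0" "ball a e \<subseteq> U"
      using assms(1) openE by blast
    \<comment> \<open>Here \<open>dist y x < e / 50\<close>, and
      \<open>20 * (e / 50) + e / 100 < e\<close>.\<close>
    have near: "P y" if x: "dist a x < e / 100" and y: "dist a y < e / 100" and "P x" for x y
    proof (rule step[OF \<open>P x\<close>])
      have "cball x (20 * dist y x) \<subseteq> ball a e"
      proof
        fix z assume "z \<in> cball x (20 * dist y x)"
        moreover have "dist y x < e / 50"
          using dist_triangle[of y x a] x y by (simp add: dist_commute)
        ultimately show "z \<in> ball a e"
          using dist_triangle[of a z x] x e(1) by (simp add: dist_commute)
      qed
      then show "cball x (20 * dist y x) \<subseteq> U" using e by blast
    qed
    show "\<exists>T. openin (top_of_set U) T \<and> a \<in> T \<and> (\<forall>x\<in>T. \<forall>y\<in>T. P x \<longrightarrow> P y)"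
    proof (intro exI conjI ballI impI)
      show "openin (top_of_set U) (ball a (e / 100))"
        using e by (intro open_subset) auto
      show "a \<in> ball a (e / 100)" using e(1) by simp
      show "P y" if "x \<in> ball a (e / 100)" "y \<in> ball a (e / 100)" "P x" for x y
        by (rule near[OF _ _ that(3)]) (use that in simp_all)
    qed
  qed
  then show ?thesis
    unfolding P_def using that by (auto simp: dist_commute)
qed

section \<open>Sums of disjoint bumps\<close>

text \<open>
  The balls may accumulate at points of \<open>C\<close>; there the quadratic bound makes the sum
  differentiable with zero gradient.
\<close>

lemma bump_sum:
  fixes f :: "'i \<Rightarrow> 'a::real_inner \<Rightarrow> real"
  assumes bump: "\<And>i. bump (f i) (D i) (c i) (r i)"
    and small: "\<And>i x y. y \<in> C \<Longrightarrow> \<bar>f i x\<bar> \<le> (dist x y)\<^sup>2"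
    and off: "\<And>i y. y \<in> C \<Longrightarrow> r i \<le> dist y (c i)"
    and disj: "\<And>i j. i \<noteq> j \<Longrightarrow> r i + r j \<le> dist (c i) (c j)"
    and fin: "\<And>y. y \<notin> C \<Longrightarrow> \<exists>e>0. finite {i. \<exists>x. dist x y < e \<and> dist x (c i) < r i}"
  obtains F G where "\<And>x. GDERIV F x :> G x"
    "\<And>i x. dist x (c i) < r i \<Longrightarrow> F x = f i x \<and> G x = D i x"
    "\<And>x. (\<And>i. r i \<le> dist x (c i)) \<Longrightarrow> F x = 0 \<and> G x = 0"
proof -
  \<comment> \<open>A point lies in at most one ball, so these sums have at most one term. As sums
    they can be compared with one over a fixed finite index set.\<close>
  define J where "J = (\<lambda>x. {i. dist x (c i) < r i})"
  define F where "F = (\<lambda>x. \<Sum>i\<in>J x. f i x)"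
  define G where "G = (\<lambda>x. \<Sum>i\<in>J x. D i x)"
  have J1: "J x = {i}" if "dist x (c i) < r i" for x i
  proof -
    have "j = i" if "dist x (c j) < r j" for j
      using disj[of i j] dist_triangle[of "c i" "c j" x] \<open>dist x (c i) < r i\<close> that
      by (force simp: dist_commute)
    then show ?thesis using that unfolding J_def by blast
  qed
  have J0: "J x = {}" if "\<And>i. r i \<le> dist x (c i)" for x
    using that by (auto simp: J_def not_less)
  have inside: "F x = f i x \<and> G x = D i x" if "dist x (c i) < r i" for x i
    using J1[OF that] by (simp add: F_def G_def)
  have outside: "F x = 0 \<and> G x = 0" if "\<And>i. r i \<le> dist x (c i)" for x
    using J0[OF that] by (simp add: F_def G_def)
  have "GDERIV F y :> G y" for y
  proof (cases "y \<in> C")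
    case True
    then have y: "F y = 0" "G y = 0" using off outside by auto
    have Fb: "\<bar>F x\<bar> \<le> (dist x y)\<^sup>2" for x
    proof (cases "\<exists>i. dist x (c i) < r i")
      case True
      then show ?thesis using inside small[OF \<open>y \<in> C\<close>] by metis
    next
      case False
      then have "F x = 0" using outside by (simp add: not_less)
      then show ?thesis by simp
    qed
    have "(F has_derivative (\<lambda>h. 0)) (at y)"
      unfolding has_derivative_at_within
    proof (intro conjI bounded_linear_zero)
      have "\<forall>\<^sub>F x in at y. norm ((F x - F y - 0) /\<^sub>R norm (x - y)) \<le> norm (x - y)"
        using Fb y by (intro always_eventually) (auto simp: dist_norm divide_simps power2_eq_square)
      moreover have "((\<lambda>x. norm (x - y)) \<longlongrightarrow> 0) (at y)"
        by (simp add: LIM_zero tendsto_norm_zero)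
      ultimately show "((\<lambda>x. (F x - F y - 0) /\<^sub>R norm (x - y)) \<longlongrightarrow> 0) (at y)"
        by (rule Lim_null_comparison)
    qed
    then show ?thesis using y by (simp add: gderiv_def)
  next
    case False
    then obtain e where e: "e > 0" and fn: "finite {i. \<exists>x. dist x y < e \<and> dist x (c i) < r i}"
      using fin by blast
    define I where "I = {i. \<exists>x. dist x y < e \<and> dist x (c i) < r i}"
    have sum_eq: "(\<Sum>i\<in>J x. h i x) = (\<Sum>i\<in>I. h i x)"
      if "dist x y < e" "\<And>i. r i \<le> dist x (c i) \<Longrightarrow> h i x = 0" for h :: "'i \<Rightarrow> 'a \<Rightarrow> 'b::comm_monoid_add" and x
    proof (rule sum.mono_neutral_left)
      show "finite I" using fn by (simp add: I_def)
      show "J x \<subseteq> I" using that by (auto simp: I_def J_def)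
      show "\<forall>i\<in>I - J x. h i x = 0" using that(2) by (simp add: J_def not_less)
    qed
    have "((\<lambda>x. \<Sum>i\<in>I. f i x) has_derivative (\<lambda>h. \<Sum>i\<in>I. inner h (D i y))) (at y)"
      using bump by (intro has_derivative_sum) (auto simp: bump_def gderiv_def)
    then have "(F has_derivative (\<lambda>h. \<Sum>i\<in>I. inner h (D i y))) (at y)"
      by (rule has_derivative_transform_within_open[of _ _ _ _ "ball y e"])
        (use e bump in \<open>auto simp: F_def bump_def dist_commute intro!: sum_eq[symmetric]\<close>)
    moreover have "G y = (\<Sum>i\<in>I. D i y)"
      unfolding G_def by (rule sum_eq) (use e bump in \<open>auto simp: bump_def\<close>)
    ultimately show ?thesis by (simp add: gderiv_def inner_sum_right)
  qed
  then show ?thesis using inside outside that by blast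
qed

section \<open>A Cantor set with a gap for each finite bit string\<close>

text \<open>
  Digits \<open>0\<close> and \<open>2\<close> encode the bits of a branch, and a tail of digits \<open>1\<close> marks the end of a
  finite node. Base \<open>5\<close> keeps all these sums uniformly apart, as digits may differ by \<open>2\<close>.
\<close>

definition cantor_sum :: "(nat \<Rightarrow> nat) \<Rightarrow> real"
  where "cantor_sum u = (\<Sum>i. real (u i) / 5 ^ Suc i)"

text \<open>The tail is dominated by a geometric series with sum \<open>1 / (2 * 5 ^ n)\<close>. The
  coefficients may be negative, since they will be differences of digits.\<close>

lemma abs_digit_series_tail_le:
  fixes w :: "nat \<Rightarrow> real"
  assumes "\<And>i. \<bar>w i\<bar> \<le> 2"
  shows "summable (\<lambda>i. w i / 5 ^ Suc i)"
    and "(\<And>i. i < n \<Longrightarrow> w i = 0) \<Longrightarrow> \<bar>\<Sum>i. w i / 5 ^ Suc i\<bar> \<le> 1 / (2 * 5 ^ n)"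
proof -
  have geo: "(\<lambda>i. 2 / 5 ^ Suc (i + m)) sums (1 / (2 * 5 ^ m) :: real)" for m
    using sums_mult[OF geometric_sums[of "1/5::real"], of "2 / 5 ^ Suc m"]
    by (simp add: power_add power_divide mult_ac)
  have le: "norm (w i / 5 ^ Suc i) \<le> 2 / 5 ^ Suc i" for i
    using assms[of i] by (simp add: abs_divide divide_right_mono del: power_Suc)
  show *: "summable (\<lambda>i. w i / 5 ^ Suc i)"
    by (rule summable_comparison_test'[OF sums_summable[OF geo[of 0]]]) (use le in simp)
  assume z: "\<And>i. i < n \<Longrightarrow> w i = 0"
  have "(\<Sum>i. w i / 5 ^ Suc i) = (\<Sum>i. w (i + n) / 5 ^ Suc (i + n))"
    using suminf_split_initial_segment[OF *, of n] z by simp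
  also have "norm \<dots> \<le> (\<Sum>i. 2 / 5 ^ Suc (i + n))"
    by (rule norm_suminf_le[OF le sums_summable[OF geo]])
  also have "\<dots> = 1 / (2 * 5 ^ n)"
    using geo sums_unique by metis
  finally show "\<bar>\<Sum>i. w i / 5 ^ Suc i\<bar> \<le> 1 / (2 * 5 ^ n)" by simp
qed

context
  fixes u v :: "nat \<Rightarrow> nat"
  assumes digits: "\<And>i. u i \<le> 2" "\<And>i. v i \<le> 2"
begin

lemma cantor_sum_diff:
  "cantor_sum u - cantor_sum v = (\<Sum>i. (real (u i) - real (v i)) / 5 ^ Suc i)"
proof -
  have "summable (\<lambda>i. real (u i) / 5 ^ Suc i)" "summable (\<lambda>i. real (v i) / 5 ^ Suc i)"
    using abs_digit_series_tail_le(1)[of "\<lambda>i. real (u i)"] abs_digit_series_tail_le(1)[of "\<lambda>i. real (v i)"]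
      digits by auto
  then show ?thesis
    unfolding cantor_sum_def by (simp add: suminf_diff diff_divide_distrib)
qed

lemma cantor_sum_close:
  assumes "\<And>i. i < n \<Longrightarrow> u i = v i"
  shows "\<bar>cantor_sum u - cantor_sum v\<bar> \<le> 1 / (2 * 5 ^ n)"
proof -
  have "\<bar>real (u i) - real (v i)\<bar> \<le> 2" for i using digits[of i] by linarith
  then show ?thesis
    unfolding cantor_sum_diff by (rule abs_digit_series_tail_le(2)) (use assms in simp)
qed

text \<open>The first differing digit, at \<open>k\<close>, moves the sum by at least
  \<open>1 / 5 ^ Suc k\<close>, and the later digits can undo at most half of that.\<close>

lemma cantor_sum_apart:
  assumes "i \<le> n" "u i \<noteq> v i"
  shows "\<bar>cantor_sum u - cantor_sum v\<bar> \<ge> 1 / (2 * 5 ^ Suc n)"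
proof -
  define k where "k = (LEAST i. u i \<noteq> v i)"
  have k: "u k \<noteq> v k" "\<And>i. i < k \<Longrightarrow> u i = v i" "k \<le> n"
    unfolding k_def using LeastI[of "\<lambda>i. u i \<noteq> v i"] assms not_less_Least
    by (fast, blast, meson Least_le order_trans)
  define w where "w = (\<lambda>i. real (u i) - real (v i))"
  \<comment> \<open>This vanishes up to and including \<open>k\<close>, so the tail estimate applies
    from \<open>Suc k\<close> on.\<close>
  define w' where "w' = (\<lambda>i. if i = k then 0 else w i)"
  have w: "\<bar>w i\<bar> \<le> 2" "\<bar>w' i\<bar> \<le> 2" for i
    using digits[of i] unfolding w_def w'_def by auto
  have "(\<lambda>i. if i = k then w k / 5 ^ Suc k else 0) sums (w k / 5 ^ Suc k)"
    by (rule sums_single)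
  from sums_add[OF summable_sums[OF abs_digit_series_tail_le(1)[of w']] this]
  have "(\<lambda>i. w i / 5 ^ Suc i) sums ((\<Sum>i. w' i / 5 ^ Suc i) + w k / 5 ^ Suc k)"
    by (rule back_subst[of "\<lambda>f. f sums _"]) (use w in \<open>auto simp: w'_def\<close>)
  then have "cantor_sum u - cantor_sum v = (\<Sum>i. w' i / 5 ^ Suc i) + w k / 5 ^ Suc k"
    unfolding cantor_sum_diff w_def by (simp add: sums_iff)
  moreover have "\<bar>\<Sum>i. w' i / 5 ^ Suc i\<bar> \<le> 1 / (2 * 5 ^ Suc k)"
    by (rule abs_digit_series_tail_le(2)[OF w(2)]) (use k in \<open>auto simp: w_def w'_def less_Suc_eq\<close>)
  moreover have "\<bar>w k / 5 ^ Suc k\<bar> \<ge> 1 / 5 ^ Suc k"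
  proof -
    have "\<bar>w k\<bar> \<ge> 1" using k(1) unfolding w_def by linarith
    then show ?thesis by (simp add: divide_right_mono)
  qed
  ultimately have "\<bar>cantor_sum u - cantor_sum v\<bar> \<ge> 1 / 5 ^ Suc k - 1 / (2 * 5 ^ Suc k)"
    by linarith
  moreover have "1 / 5 ^ Suc k - 1 / (2 * 5 ^ Suc k) = (1::real) / (2 * 5 ^ Suc k)"
    by simp
  moreover have "(1::real) / (2 * 5 ^ Suc k) \<ge> 1 / (2 * 5 ^ Suc n)"
    using k(3) by (intro divide_left_mono mult_left_mono power_increasing) auto
  ultimately show ?thesis by linarith
qed

end

definition branch_digit :: "(nat \<Rightarrow> bool) \<Rightarrow> nat \<Rightarrow> nat"
  where "branch_digit a i = (if a i then 2 else 0)"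

definition node_digit :: "bool list \<Rightarrow> nat \<Rightarrow> nat"
  where "node_digit s i = (if i < length s then (if s ! i then 2 else 0) else 1)"

lemma digit_le_2: "branch_digit a i \<le> 2" "node_digit s i \<le> 2"
  by (auto simp: branch_digit_def node_digit_def)

section \<open>Countable families of targets and of closed sets\<close>

text \<open>Pair codes repeat each point of a countable dense set infinitely often. In the tree this
  provides targets at arbitrarily great depth.\<close>

lemma ex_dense_sequence:
  obtains d :: "nat \<Rightarrow> 'a::second_countable_topology"
  where "\<And>S n. open S \<Longrightarrow> S \<noteq> {} \<Longrightarrow> \<exists>i\<ge>n. d i \<in> S"
proof -
  obtain E :: "'a set" where E: "countable E" "\<And>X. open X \<Longrightarrow> X \<noteq> {} \<Longrightarrow> \<exists>e\<in>E. e \<in> X"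
    using countable_dense_exists by blast
  have "E \<noteq> {}" using E(2)[of UNIV] by auto
  define d where "d i = from_nat_into E (fst (prod_decode i))" for i
  have "\<exists>i\<ge>n. d i \<in> S" if "open S" "S \<noteq> {}" for S n
  proof -
    obtain e where "e \<in> E" "e \<in> S" using E(2)[OF \<open>open S\<close> \<open>S \<noteq> {}\<close>] by blast
    then have "d (prod_encode (to_nat_on E e, n)) \<in> S"
      using E(1) by (simp add: d_def)
    then show ?thesis using le_prod_encode_2 by blast
  qed
  then show ?thesis using that by blast
qed

text \<open>Closures of the members of a countable basis. Gradients that approach \<open>p\<close>
  must enter the set chosen for \<open>p\<close>, hence the interior.\<close>

lemma ex_closed_neighbourhood_sequence:
  obtains V :: "nat \<Rightarrow> 'a::{second_countable_topology, metric_space} set"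
  where "\<And>i. closed (V i)"
    "\<And>S p. open S \<Longrightarrow> p \<in> S \<Longrightarrow> \<exists>i. p \<in> interior (V i) \<and> V i \<subseteq> S"
proof -
  obtain B :: "nat \<Rightarrow> 'a set" where B: "\<And>S p. open S \<Longrightarrow> p \<in> S \<Longrightarrow> \<exists>i. p \<in> B i \<and> B i \<subseteq> S" "\<And>i. open (B i)"
  proof -
    obtain \<B> :: "'a set set" where \<B>: "countable \<B>" "topological_basis \<B>"
      using ex_countable_basis by blast
    \<comment> \<open>The inserted empty set keeps the enumerated family nonempty.\<close>
    show ?thesis
    proof (rule that[of "\<lambda>i. from_nat_into (insert {} \<B>) i"])
      show "\<exists>i. p \<in> from_nat_into (insert {} \<B>) i \<and> from_nat_into (insert {} \<B>) i \<subseteq> S"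
        if "open S" "p \<in> S" for S p
      proof -
        obtain B where "B \<in> \<B>" "p \<in> B" "B \<subseteq> S"
          using topological_basisE[OF \<B>(2) \<open>open S\<close> \<open>p \<in> S\<close>] .
        then show ?thesis
          using \<B>(1) from_nat_into_surj[of "insert {} \<B>" B] by auto
      qed
      show "open (from_nat_into (insert {} \<B>) i)" for i
        using from_nat_into[of "insert {} \<B>" i] topological_basis_open[OF \<B>(2)] by auto
    qed
  qed
  have "\<exists>i. p \<in> interior (closure (B i)) \<and> closure (B i) \<subseteq> S" if S: "open S" "p \<in> S" for S p
  proof -
    obtain e where e: "e > 0" "cball p e \<subseteq> S" using S open_contains_cball by blast
    obtain i where i: "p \<in> B i" "B i \<subseteq> ball p e" using B(1)[of "ball p e" p] e by auto
    then have "closure (B i) \<subseteq> cball p e"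
      by (intro closure_minimal) auto
    moreover have "p \<in> interior (closure (B i))"
      using i(1) B(2) closure_subset by (intro interiorI)
    ultimately show ?thesis using e by blast
  qed
  then show ?thesis using that[of "\<lambda>i. closure (B i)"] by auto
qed

section \<open>One bump for all continua containing \<open>0\<close>\<close>

lemma small_bump_hitting:
  fixes U :: "'a::euclidean_space set"
  assumes "open U" "connected U" "0 \<in> U" "d \<in> U" "r > 0" "\<epsilon> > 0"
  obtains f D x where "bump f D c r" "range D \<subseteq> U" "\<And>x. \<bar>f x\<bar> \<le> \<epsilon>" "dist x c < r" "D x = d"
proof -
  obtain f D b s where f: "bump f D 0 1" "range D \<subseteq> U" and s: "s > 0" "norm b + s \<le> 1"
    and d: "\<And>x. x \<in> ball b s \<Longrightarrow> D x = d"
    using bump_in_connected_open assms by metis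
  obtain B where B: "B > 0" "\<And>x. \<bar>f x\<bar> \<le> B"
    using bump_bounded[OF f(1)] by blast
  define t where "t = min r (\<epsilon> / B)"
  have t: "t > 0" "t \<le> r" "t * B \<le> \<epsilon>"
    using assms B by (auto simp: t_def min_def field_simps)
  show ?thesis
  proof (rule that[of "\<lambda>x. t * f ((x - c) /\<^sub>R t)" "\<lambda>x. D ((x - c) /\<^sub>R t)" "c + t *\<^sub>R b"])
    show "bump (\<lambda>x. t * f ((x - c) /\<^sub>R t)) (\<lambda>x. D ((x - c) /\<^sub>R t)) c r"
      using bump_mono[OF bump_rescale[OF f(1) t(1)]] t(2) by simp
    show "range (\<lambda>x. D ((x - c) /\<^sub>R t)) \<subseteq> U" using f by auto
    show "\<bar>t * f ((x - c) /\<^sub>R t)\<bar> \<le> \<epsilon>" for x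
      using order_trans[OF mult_left_mono[OF B(2), of t "(x - c) /\<^sub>R t"] t(3)] t(1) by (simp add: abs_mult)
    have "t * norm b < r" using s t by (intro less_le_trans[OF _ t(2)]) simp
    then show "dist (c + t *\<^sub>R b) c < r" using t by (simp add: dist_norm)
    show "D ((c + t *\<^sub>R b - c) /\<^sub>R t) = d" using d[of b] s t by simp
  qed
qed

text \<open>A single function serves all \<open>K\<close>, as each \<open>K\<close> selects its own
  point of the Cantor set. \<open>R\<close> bounds all gradients at once, which the Lipschitz
  estimate uses later.\<close>

lemma cantor_bump:
  fixes R :: real
  assumes R: "R > 0"
  obtains f :: "'a::euclidean_space \<Rightarrow> real" and D where
    "bump f D 0 1" "range D \<subseteq> ball 0 R"
    "\<And>K. closed K \<Longrightarrow> connected K \<Longrightarrow> 0 \<in> K \<Longrightarrow> K \<subseteq> ball 0 R \<Longrightarrow>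
      \<exists>x. norm x < 1 \<and> gradient_limits D x = K"
proof -
  obtain d :: "nat \<Rightarrow> 'a" where d: "\<And>S n. open S \<Longrightarrow> S \<noteq> {} \<Longrightarrow> \<exists>i\<ge>n. d i \<in> S"
    using ex_dense_sequence by blast
  obtain V :: "nat \<Rightarrow> 'a set" where V: "\<And>i. closed (V i)"
    "\<And>S p. open S \<Longrightarrow> p \<in> S \<Longrightarrow> \<exists>i. p \<in> interior (V i) \<and> V i \<subseteq> S"
    using ex_closed_neighbourhood_sequence by blast
  obtain b :: 'a where "b \<in> Basis" using nonempty_Basis by blast
  then have b: "norm b = 1" by simp
  \<comment> \<open>\<open>U s\<close> is empty if \<open>0\<close> has been excluded; the bump at \<open>s\<close> is then zero.\<close>
  define A where "A = (\<lambda>s::bool list. ball 0 R - (\<Union>i\<in>{i. i < length s \<and> s ! i}. V i))"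
  define U where "U = (\<lambda>s. connected_component_set (A s) 0)"
  define m where "m = (\<lambda>s. cantor_sum (node_digit s) *\<^sub>R b)"
  define X where "X = (\<lambda>a. cantor_sum (branch_digit a) *\<^sub>R b)"
  \<comment> \<open>Half the separation from \<open>cantor_sum_apart\<close> at depth
    \<open>length s\<close>: the balls are disjoint and stay at distance at least \<open>r s\<close>
    from the Cantor set, so height \<open>(r s)\<^sup>2\<close> meets the quadratic bound.\<close>
  define r where "r = (\<lambda>s::bool list. 1 / (4 * 5 ^ Suc (length s)) :: real)"
  have dist_b: "dist (p *\<^sub>R b) (q *\<^sub>R b) = \<bar>p - q\<bar>" for p q
    using b by (simp add: dist_norm flip: scaleR_diff_left)
  have r: "r s > 0" for s by (simp add: r_def)
  have U_sub: "U s \<subseteq> A s" for s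
    unfolding U_def by (rule connected_component_subset)
  have U_ball: "U s \<subseteq> ball 0 R" for s
    using U_sub[of s] unfolding A_def by blast
  have U_open: "open (U s)" for s
    unfolding U_def A_def using V(1) by (intro open_connected_component open_Diff closed_UN) auto
  have "\<exists>f D. bump f D (m s) (r s) \<and> (\<forall>x. \<bar>f x\<bar> \<le> (r s)\<^sup>2) \<and> range D \<subseteq> insert 0 (U s) \<and>
      (d (length s) \<in> U s \<longrightarrow> (\<exists>x. dist x (m s) < r s \<and> D x = d (length s)))" for s
  proof (cases "d (length s) \<in> U s")
    case True
    then have "0 \<in> U s"
      unfolding U_def using connected_component_in by fastforce
    have "connected (U s)" by (simp add: U_def)
    obtain f D x where "bump f D (m s) (r s)" "range D \<subseteq> U s" "\<And>x. \<bar>f x\<bar> \<le> (r s)\<^sup>2"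
        "dist x (m s) < r s" "D x = d (length s)"
      using small_bump_hitting[OF U_open \<open>connected (U s)\<close> \<open>0 \<in> U s\<close> True r, of "(r s)\<^sup>2"]
        r[of s] by (metis zero_less_power)
    then show ?thesis by blast
  next
    case False
    moreover have "bump (\<lambda>_. 0) (\<lambda>_. 0) (m s) (r s)"
      by (simp add: bump_def GDERIV_const)
    ultimately show ?thesis
      by (intro exI[of _ "\<lambda>_. 0"]) auto
  qed
  then obtain f D where f: "\<And>s. bump (f s) (D s) (m s) (r s)" "\<And>s x. \<bar>f s x\<bar> \<le> (r s)\<^sup>2"
    "\<And>s. range (D s) \<subseteq> insert 0 (U s)"
    "\<And>s. d (length s) \<in> U s \<Longrightarrow> \<exists>x. dist x (m s) < r s \<and> D s x = d (length s)"
    by metis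
  \<comment> \<open>With the closure, every point outside \<open>C\<close> has a ball that misses
    \<open>C\<close>, as local finiteness requires.\<close>
  define C where "C = closure (range X)"
  have r2: "1 / (2 * 5 ^ Suc (length s)) = 2 * r s" for s
    by (simp add: r_def)
  \<comment> \<open>At index \<open>length s\<close> the node has digit \<open>1\<close>, a branch
    \<open>0\<close> or \<open>2\<close>.\<close>
  have apart_X: "2 * r s \<le> dist (m s) (X a)" for s a
    unfolding m_def X_def dist_b r2[symmetric]
    by (rule cantor_sum_apart[of _ _ "length s"])
      (auto simp: digit_le_2, auto simp: node_digit_def branch_digit_def split: if_splits)
  have apart: "2 * r s \<le> dist (m s) y" if "y \<in> C" for s y
  proof -
    have "closed {y. 2 * r s \<le> dist (m s) y}"
      by (intro closed_Collect_le continuous_intros)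
    then have "C \<subseteq> {y. 2 * r s \<le> dist (m s) y}"
      unfolding C_def using apart_X by (intro closure_minimal) auto
    then show ?thesis using that by blast
  qed
  have apart_m: "2 * r s \<le> dist (m s) (m t)" if "s \<noteq> t" for s t
  proof -
    have "\<exists>i\<le>length s. node_digit s i \<noteq> node_digit t i"
    proof (cases "length s = length t")
      case True
      then obtain i where "i < length s" "s ! i \<noteq> t ! i"
        using \<open>s \<noteq> t\<close> by (auto simp: list_eq_iff_nth_eq)
      then show ?thesis using True by (intro exI[of _ i]) (auto simp: node_digit_def)
    next
      case False
      then show ?thesis
        by (intro exI[of _ "min (length s) (length t)"]) (auto simp: node_digit_def min_def)
    qed
    then show ?thesis
      unfolding m_def dist_b r2[symmetric] using cantor_sum_apart digit_le_2(2) by metis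
  qed
  have close: "dist (X a) (m s) \<le> 1 / (2 * 5 ^ n)"
    if "\<And>i. i < n \<Longrightarrow> branch_digit a i = node_digit s i" for a s n
    unfolding m_def X_def dist_b by (rule cantor_sum_close) (auto simp: digit_le_2 that)
  have small: "\<bar>f s x\<bar> \<le> (dist x y)\<^sup>2" if "y \<in> C" for s x y
  proof (cases "dist x (m s) < r s")
    case True
    then have "r s \<le> dist x y"
      using apart[OF \<open>y \<in> C\<close>, of s] dist_triangle[of "m s" y x] by (simp add: dist_commute)
    then show ?thesis
      using f(2)[of s x] r[of s] power_mono[of "r s" "dist x y" 2] by linarith
  next
    case False
    then show ?thesis using f(1)[of s] by (simp add: bump_def)
  qed
  have off: "r s \<le> dist y (m s)" if "y \<in> C" for s y
    using apart[OF that, of s] r[of s] by (simp add: dist_commute)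
  have disj: "r s + r t \<le> dist (m s) (m t)" if "s \<noteq> t" for s t
    using apart_m[OF that] apart_m[of t s] that by (simp add: dist_commute)
  have fin: "\<exists>e>0. finite {s. \<exists>x. dist x y < e \<and> dist x (m s) < r s}" if "y \<notin> C" for y
  proof -
    from that obtain e where e: "e > 0" "ball y e \<subseteq> - C"
      by (metis C_def ComplI closed_closure open_Compl openE)
    obtain N where N: "1 / 5 ^ N < e / 2"
      using real_arch_pow_inv[of "e / 2" "1/5"] e(1) by (auto simp: power_divide)
    have "length s \<le> N" if "dist x y < e / 2" "dist x (m s) < r s" for s x
    proof (rule ccontr)
      assume "\<not> length s \<le> N"
      \<comment> \<open>The branch through \<open>s\<close> continued by \<open>False\<close>: a
        long node near \<open>y\<close> would bring this point of \<open>C\<close> into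
        \<open>ball y e\<close>.\<close>
      let ?a = "\<lambda>i. i < length s \<and> s ! i"
      have "X ?a \<in> C"
        unfolding C_def using closure_subset by fast
      then have "e \<le> dist y (X ?a)" using e(2) by force
      moreover have "dist (X ?a) (m s) \<le> 1 / (2 * 5 ^ length s)"
        by (rule close) (auto simp: branch_digit_def node_digit_def)
      moreover have "dist y (X ?a) \<le> dist x y + (dist x (m s) + dist (X ?a) (m s))"
        using dist_triangle[of y "X ?a" x] dist_triangle[of x "X ?a" "m s"] by (simp add: dist_commute)
      moreover have "r s + 1 / (2 * 5 ^ length s) \<le> 1 / 5 ^ length s"
        by (simp add: r_def field_simps)
      moreover have "(1::real) / 5 ^ length s \<le> 1 / 5 ^ N"
        using \<open>\<not> length s \<le> N\<close> by (intro divide_left_mono power_increasing) auto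
      ultimately show False using that N by linarith
    qed
    then have "{s. \<exists>x. dist x y < e / 2 \<and> dist x (m s) < r s} \<subseteq> {s. set s \<subseteq> UNIV \<and> length s \<le> N}"
      by blast
    then have "finite {s. \<exists>x. dist x y < e / 2 \<and> dist x (m s) < r s}"
      by (rule finite_subset) (rule finite_lists_length_le, simp)
    then show "\<exists>e>0. finite {s. \<exists>x. dist x y < e \<and> dist x (m s) < r s}"
      using e(1) by (intro exI[of _ "e / 2"]) auto
  qed
  obtain F G where F: "\<And>x. GDERIV F x :> G x"
    and inside: "\<And>s x. dist x (m s) < r s \<Longrightarrow> F x = f s x \<and> G x = D s x"
    and outside: "\<And>x. (\<And>s. r s \<le> dist x (m s)) \<Longrightarrow> F x = 0 \<and> G x = 0"
    using bump_sum[OF f(1) small off disj fin] by blast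
  have G_cases: "G x = 0 \<or> (\<exists>s. dist x (m s) < r s \<and> G x \<in> U s)" for x
  proof (cases "\<exists>s. dist x (m s) < r s")
    case True
    then obtain s where s: "dist x (m s) < r s" by blast
    then have "G x \<in> insert 0 (U s)" using inside f(3)[of s] by (metis rangeI subsetD)
    then show ?thesis using s by blast
  next
    case False
    then have "G x = 0" using outside[of x] by (simp add: not_less)
    then show ?thesis ..
  qed
  have half: "\<bar>cantor_sum u\<bar> \<le> 1 / 2" if "\<And>i. u i \<le> 2" for u
    using cantor_sum_close[of u "\<lambda>_. 0" 0] that by (simp add: cantor_sum_def)
  show ?thesis
  proof (rule that[of F G])
    show "bump F G 0 1"
      unfolding bump_def
    proof (intro conjI allI impI F)
      fix x :: 'a assume x: "1 \<le> dist x 0"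
      have "r s \<le> dist x (m s)" for s
      proof -
        have "norm (m s) \<le> 1 / 2" using half[of "node_digit s"] b by (simp add: m_def digit_le_2)
        moreover have "norm x \<le> dist x (m s) + norm (m s)"
          by (metis dist_norm norm_triangle_sub add.commute)
        moreover have "r s \<le> 1 / 4"
          using one_le_power[of "5::real" "Suc (length s)"] unfolding r_def
          by (intro divide_left_mono) (auto simp del: power_Suc)
        ultimately show ?thesis using x by simp
      qed
      then show "F x = 0" "G x = 0" using outside by auto
    qed
    show "range G \<subseteq> ball 0 R"
    proof safe
      fix x show "G x \<in> ball 0 R"
        using G_cases[of x] subsetD[OF U_ball] centre_in_ball[of "0::'a" R] R by metis
    qed
    fix K :: "'a set" assume K: "closed K" "connected K" "0 \<in> K" "K \<subseteq> ball 0 R"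
    define a where "a = (\<lambda>i. V i \<inter> K = {})"
    have "norm (X a) < 1"
      using half[of "branch_digit a"] b by (simp add: X_def digit_le_2)
    moreover have "p \<in> gradient_limits G (X a)" if "p \<in> K" for p
      unfolding gradient_limits_def
    proof safe
      fix e :: real assume "e > 0"
      then obtain n where n: "1 / 5 ^ n < e"
        using real_arch_pow_inv[of e "1/5"] by (auto simp: power_divide)
      define s where "s = map a [0..<n]"
      \<comment> \<open>Only sets disjoint from \<open>K\<close> are removed along its branch, so
        the connected set \<open>K\<close> stays in the component of \<open>0\<close>.\<close>
      have "K \<subseteq> A s" using K(4) by (auto simp: A_def s_def a_def)
      then have "K \<subseteq> U s"
        unfolding U_def using K by (intro connected_component_maximal)
      then have "p \<in> U s \<inter> ball p e" using that \<open>e > 0\<close> by auto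
      then obtain j where j: "j \<ge> n" "d j \<in> U s \<inter> ball p e"
        using d[of "U s \<inter> ball p e" n] U_open by blast
      \<comment> \<open>The target of a node depends on its length only; padding with \<open>False\<close> excludes nothing
        new, so any target in \<open>U s\<close> is attained below \<open>s\<close>.\<close>
      define t where "t = s @ replicate (j - n) False"
      have t: "length t = j" using j by (simp add: t_def s_def)
      have "{i. i < length t \<and> t ! i} = {i. i < length s \<and> s ! i}"
        by (auto simp: t_def nth_append) (rule ccontr, simp)
      then have "U t = U s" by (simp add: U_def A_def)
      then obtain y where y: "dist y (m t) < r t" "D t y = d j"
        using f(4)[of t] j t by auto
      have "dist (X a) (m t) \<le> 1 / (2 * 5 ^ n)"
        by (rule close) (use j in \<open>auto simp: branch_digit_def node_digit_def t_def s_def nth_append\<close>)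
      moreover have "r t \<le> 1 / (4 * 5 ^ n)"
        unfolding r_def t using j(1) by (intro divide_left_mono mult_left_mono power_increasing) auto
      moreover have "1 / (2 * 5 ^ n) + 1 / (4 * 5 ^ n) \<le> 1 / (5::real) ^ n"
        by (simp add: field_simps)
      ultimately have "dist y (X a) < e"
        using y(1) n dist_triangle[of y "X a" "m t"] by (simp only: dist_commute)
      moreover have "dist (G y) p < e"
        using inside[OF y(1)] y(2) j by (simp add: dist_commute)
      ultimately show "\<exists>y. dist y (X a) < e \<and> dist (G y) p < e" by blast
    qed
    \<comment> \<open>A point outside \<open>K\<close> has a neighbourhood \<open>V i\<close> that
      misses \<open>K\<close>. Nodes near \<open>X a\<close> agree with \<open>a\<close> at index
      \<open>i\<close>, where \<open>V i\<close> has been removed.\<close>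
    moreover have "p \<in> K" if p: "p \<in> gradient_limits G (X a)" for p
    proof (rule ccontr)
      assume "p \<notin> K"
      then obtain i where i: "p \<in> interior (V i)" "V i \<subseteq> - K"
        using V(2)[of "- K" p] K(1) by auto
      then obtain e where e: "e > 0" "ball p e \<subseteq> V i"
        using mem_interior by blast
      define \<delta> where "\<delta> = 1 / (4 * 5 ^ Suc i :: real)"
      have "min e \<delta> > 0" using e by (simp add: \<delta>_def)
      then obtain y where y: "dist y (X a) < min e \<delta>" "dist (G y) p < min e \<delta>"
        using p unfolding gradient_limits_def by blast
      then have Gy: "G y \<in> V i" using e by (auto simp: dist_commute)
      \<comment> \<open>As \<open>0\<close> is in \<open>K\<close>, it is not in \<open>V i\<close>;
        so \<open>y\<close> lies in some ball and its gradient in the component there.\<close>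
      then have "G y \<noteq> 0" using i K(3) by auto
      then obtain s where s: "dist y (m s) < r s" "G y \<in> U s"
        using G_cases by blast
      have ai: "a i" using i(2) by (auto simp: a_def)
      have "node_digit s i = branch_digit a i"
      proof (rule ccontr)
        assume ne: "node_digit s i \<noteq> branch_digit a i"
        have "1 / (2 * 5 ^ Suc i) \<le> dist (m s) (X a)"
          unfolding m_def X_def dist_b
          using cantor_sum_apart[of "node_digit s" "branch_digit a" i i] ne digit_le_2 by simp
        then have "2 * \<delta> \<le> dist (m s) (X a)" by (simp add: \<delta>_def)
        moreover have "dist (m s) (X a) \<le> dist y (m s) + dist y (X a)"
          using dist_triangle[of "m s" "X a" y] by (simp add: dist_commute)
        \<comment> \<open>\<open>dist (m s) (X a)\<close> is at least \<open>2 * r s\<close> and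
          \<open>2 * \<delta>\<close>, yet less than \<open>r s + \<delta>\<close>.\<close>
        ultimately show False
          using apart_X[of s a] s(1) y(1) by linarith
      qed
      \<comment> \<open>The digit is \<open>2\<close>, so it belongs neither to the tail of ones nor
        to a bit \<open>False\<close>.\<close>
      then have "i < length s" "s ! i"
        using ai by (auto simp: node_digit_def branch_digit_def split: if_splits)
      then have "U s \<inter> V i = {}" using U_sub[of s] by (auto simp: A_def)
      then show False using s Gy by blast
    qed
    ultimately show "\<exists>x. norm x < 1 \<and> gradient_limits G x = K" by blast
  qed
qed

section \<open>Arbitrary centres and the global function\<close>

text \<open>A rescaled bump from \<open>cantor_bump\<close> is added where another bump has constant
  gradient \<open>q\<close>. This shifts its gradient limits by \<open>q\<close>, so the translate
  of \<open>K\<close> by \<open>- q\<close> is the set to realise.\<close>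

lemma cantor_bump_centred:
  fixes q :: "'a::euclidean_space" and R :: real
  assumes R: "R > 0"
  obtains f D M where "bump f D 0 1" "\<And>x. norm (D x) \<le> M"
    "\<And>K. closed K \<Longrightarrow> connected K \<Longrightarrow> q \<in> K \<Longrightarrow> K \<subseteq> ball q R \<Longrightarrow>
      \<exists>x. norm x < 1 \<and> gradient_limits D x = K"
proof -
  obtain g E c r where g: "bump g E 0 1" "range E \<subseteq> ball 0 (norm q + 1)"
    and r: "r > 0" "norm c + r \<le> 1" and E: "\<And>x. x \<in> ball c r \<Longrightarrow> E x = q"
    by (rule bump_in_connected_open[of "ball 0 (norm q + 1)" q]) (auto simp: add_nonneg_pos)
  obtain h :: "'a \<Rightarrow> real" and D where h: "bump h D 0 1" "range D \<subseteq> ball 0 R"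
    and D: "\<And>K. closed K \<Longrightarrow> connected K \<Longrightarrow> 0 \<in> K \<Longrightarrow> K \<subseteq> ball 0 R \<Longrightarrow>
      \<exists>x. norm x < 1 \<and> gradient_limits D x = K"
    using cantor_bump[OF R] by blast
  define G where "G = (\<lambda>x. E x + D ((x - c) /\<^sub>R r))"
  show ?thesis
  proof (rule that)
    show "bump (\<lambda>x. g x + r * h ((x - c) /\<^sub>R r)) G 0 1"
      unfolding G_def using bump_add[OF g(1) bump_rescale[OF h(1) r(1)]] r by simp
    show "norm (G x) \<le> norm q + 1 + R" for x
    proof -
      have "norm (E x) < norm q + 1" "norm (D ((x - c) /\<^sub>R r)) < R"
        using g(2) h(2) by (auto simp: image_subset_iff)
      then show ?thesis
        unfolding G_def using norm_triangle_ineq[of "E x" "D ((x - c) /\<^sub>R r)"] by linarith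
    qed
    fix K assume K: "closed K" "connected K" "q \<in> K" "K \<subseteq> ball q R"
    define K' where "K' = (\<lambda>p. p - q) ` K"
    have "closed K'" "connected K'" "0 \<in> K'"
      unfolding K'_def using K
      by (auto intro!: closed_translation_subtract connected_continuous_image continuous_intros)
    moreover have "K' \<subseteq> ball 0 R"
      using K(4) by (auto simp: K'_def dist_norm norm_minus_commute)
    ultimately obtain x where x: "norm x < 1" "gradient_limits D x = K'"
      using D by blast
    have "gradient_limits G (c + r *\<^sub>R x) = (+) q ` gradient_limits D x"
    proof (rule gradient_limits_affine)
      \<comment> \<open>With this radius the ball around the image of \<open>x\<close> stays in
        \<open>ball c r\<close>, where \<open>E\<close> is \<open>q\<close>.\<close>
      show "r * (1 - norm x) > 0" using r x by simp
      fix y assume "dist y (c + r *\<^sub>R x) < r * (1 - norm x)"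
      moreover have "dist (c + r *\<^sub>R x) c = r * norm x" using r by (simp add: dist_norm)
      ultimately have "y \<in> ball c r"
        using dist_triangle[of y c "c + r *\<^sub>R x"] by (simp add: dist_commute algebra_simps)
      then show "G y = q + D ((y - c) /\<^sub>R r)"
        unfolding G_def using E by simp
    qed (rule r)
    also have "\<dots> = K"
      unfolding x(2) K'_def by (simp add: image_image)
    finally have "gradient_limits G (c + r *\<^sub>R x) = K" .
    moreover have "norm (c + r *\<^sub>R x) < 1"
    proof -
      have "norm (r *\<^sub>R x) < r" using r x by simp
      then show ?thesis
        using norm_triangle_ineq[of c "r *\<^sub>R x"] r by linarith
    qed
    ultimately show "\<exists>x. norm x < 1 \<and> gradient_limits G x = K" by blast
  qed
qed

text \<open>The mean value inequality on a convex ball; half the radius keeps the closed ball inside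
  the open one.\<close>

lemma locally_lipschitz_if_gradient_bounded:
  assumes "\<And>x. GDERIV f x :> G x"
    and "\<And>y. \<exists>e>0. \<exists>M. \<forall>x. dist x y < e \<longrightarrow> norm (G x) \<le> M"
  shows "locally_lipschitz f"
  unfolding locally_lipschitz_def
proof
  fix y
  obtain e M where e: "e > 0" and M: "\<And>x. dist x y < e \<Longrightarrow> norm (G x) \<le> M"
    using assms(2) by blast
  have "M-lipschitz_on (cball y (e / 2)) f"
  proof (rule bounded_derivative_imp_lipschitz)
    show "(f has_derivative (\<lambda>h. inner h (G x))) (at x within cball y (e / 2))" for x
      using assms(1)[of x] unfolding gderiv_def by (rule has_derivative_at_withinI)
    show "0 \<le> M"
      using M[of y] e norm_ge_zero order_trans by (metis dist_self)
    then show "onorm (\<lambda>h. inner h (G x)) \<le> M" if "x \<in> cball y (e / 2)" for x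
    proof (rule onorm_bound)
      have "norm (G x) \<le> M" using M[of x] that e by (simp add: dist_commute)
      then show "norm (inner h (G x)) \<le> M * norm h" for h
        using order_trans[OF Cauchy_Schwarz_ineq2[of h "G x"] mult_left_mono[of "norm (G x)" M "norm h"]]
        by (simp add: mult.commute)
    qed
  qed simp
  then show "\<exists>u>0. \<exists>L. L-lipschitz_on (cball y u) f"
    using e half_gt_zero by blast
qed

lemma ex_universal_subdifferential:
  assumes "\<epsilon> > 0"
  obtains f :: "'a::euclidean_space \<Rightarrow> real"
  where "\<And>x. f differentiable (at x)" "locally_lipschitz f" "\<And>x. \<bar>f x\<bar> \<le> \<epsilon>"
    "\<And>K. compact K \<Longrightarrow> connected K \<Longrightarrow> interior K \<noteq> {} \<Longrightarrow>
      \<exists>x. limiting_subdifferential f x = K"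
proof -
  obtain d :: "nat \<Rightarrow> 'a" where d: "\<And>S n. open S \<Longrightarrow> S \<noteq> {} \<Longrightarrow> \<exists>i\<ge>n. d i \<in> S"
    using ex_dense_sequence by blast
  obtain b :: 'a where "b \<in> Basis" using nonempty_Basis by blast
  then have b: "norm b = 1" by simp
  \<comment> \<open>The index \<open>i\<close> codes a centre from the dense sequence together with
    a natural number for the radius.\<close>
  define q where "q = (\<lambda>i. d (fst (prod_decode i)))"
  define R where "R = (\<lambda>i. real (Suc (snd (prod_decode i))))"
  define p where "p = (\<lambda>i. real (2 * i) *\<^sub>R b)"
  have "\<exists>f D M. bump f D 0 1 \<and> (\<forall>x. norm (D x) \<le> M) \<and>
    (\<forall>K. closed K \<longrightarrow> connected K \<longrightarrow> q i \<in> K \<longrightarrow> K \<subseteq> ball (q i) (R i) \<longrightarrow>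
      (\<exists>x. norm x < 1 \<and> gradient_limits D x = K))" for i
    using cantor_bump_centred[of "R i" "q i"] unfolding R_def by (metis of_nat_0_less_iff zero_less_Suc)
  then obtain h D M where h: "\<And>i. bump (h i) (D i) 0 1" and M: "\<And>i x. norm (D i x) \<le> M i"
    and D: "\<And>i K. closed K \<Longrightarrow> connected K \<Longrightarrow> q i \<in> K \<Longrightarrow> K \<subseteq> ball (q i) (R i) \<Longrightarrow>
      \<exists>x. norm x < 1 \<and> gradient_limits (D i) x = K"
    by metis
  \<comment> \<open>The factor \<open>t\<close> lowers the height to \<open>\<epsilon>\<close> and
    leaves the gradients unchanged; \<open>t \<le> 1\<close> keeps the support in a unit
    ball.\<close>
  have "\<exists>t. 0 < t \<and> t \<le> 1 \<and> (\<forall>x. \<bar>t * h i x\<bar> \<le> \<epsilon>)" for i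
  proof -
    obtain B where B: "B > 0" "\<And>x. \<bar>h i x\<bar> \<le> B"
      using bump_bounded[OF h[of i]] by blast
    have t: "min 1 (\<epsilon> / B) > 0" "min 1 (\<epsilon> / B) * B \<le> \<epsilon>"
      using assms B by (auto simp: min_def field_simps)
    have "\<bar>min 1 (\<epsilon> / B) * h i x\<bar> \<le> \<epsilon>" for x
      using order_trans[OF mult_left_mono[OF B(2) less_imp_le[OF t(1)], of x] t(2)] t(1)
      by (simp add: abs_mult)
    then show ?thesis using t by (intro exI[of _ "min 1 (\<epsilon> / B)"]) auto
  qed
  then obtain t where t: "\<And>i. 0 < t i" "\<And>i. t i \<le> 1" "\<And>i x. \<bar>t i * h i x\<bar> \<le> \<epsilon>"
    by metis
  define f where "f = (\<lambda>i x. t i * h i ((x - p i) /\<^sub>R t i))"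
  define D' where "D' = (\<lambda>i x. D i ((x - p i) /\<^sub>R t i))"
  have bump: "bump (f i) (D' i) (p i) 1" for i
    unfolding f_def D'_def using bump_mono[OF bump_rescale[OF h t(1)]] t(2) by simp
  have disj: "1 + 1 \<le> dist (p i) (p j)" if "i \<noteq> j" for i j
  proof -
    have "dist (p i) (p j) = \<bar>real (2 * i) - real (2 * j)\<bar>"
      using b by (simp add: p_def dist_norm flip: scaleR_diff_left)
    then show ?thesis using that by linarith
  qed
  have fin: "finite {i. \<exists>x. dist x y < 1 \<and> dist x (p i) < 1}" for y
  proof (rule finite_subset)
    show "{i. \<exists>x. dist x y < 1 \<and> dist x (p i) < 1} \<subseteq> {..nat \<lceil>norm y + 2\<rceil>}"
    proof safe
      fix i x assume "dist x y < 1" "dist x (p i) < 1"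
      then have "dist (p i) y < 2"
        using dist_triangle[of "p i" y x] by (simp add: dist_commute)
      moreover have "norm (p i) = 2 * real i" using b by (simp add: p_def)
      moreover have "norm (p i) \<le> dist (p i) y + norm y"
        by (metis dist_norm norm_triangle_sub add.commute)
      ultimately have "real i \<le> norm y + 2" by linarith
      then show "i \<le> nat \<lceil>norm y + 2\<rceil>" by linarith
    qed
  qed simp
  obtain F G where F: "\<And>x. GDERIV F x :> G x"
    and inside: "\<And>i x. dist x (p i) < 1 \<Longrightarrow> F x = f i x \<and> G x = D' i x"
    and outside: "\<And>x. (\<And>i. 1 \<le> dist x (p i)) \<Longrightarrow> F x = 0 \<and> G x = 0"
  \<comment> \<open>The balls do not accumulate anywhere, so the exceptional set is empty and the
    quadratic bound is vacuous.\<close>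
  proof (rule bump_sum[OF bump, of "{}"])
    show "1 + 1 \<le> dist (p i) (p j)" if "i \<noteq> j" for i j using disj[OF that] .
    show "\<exists>e>0. finite {i. \<exists>x. dist x y < e \<and> dist x (p i) < 1}" for y
      using fin[of y] zero_less_one by blast
  qed (use that in auto)
  show ?thesis
  proof (rule that[of F])
    show "F differentiable (at x)" for x
      using F[of x] unfolding gderiv_def differentiable_def by blast
    show "\<bar>F x\<bar> \<le> \<epsilon>" for x
    proof (cases "\<exists>i. dist x (p i) < 1")
      case True
      then show ?thesis using inside t(3) unfolding f_def by metis
    next
      case False
      then have "F x = 0" using outside by (simp add: not_less)
      then show ?thesis using assms by simp
    qed
    show "locally_lipschitz F"
    proof (rule locally_lipschitz_if_gradient_bounded[OF F])
      fix y
      let ?J = "{i. \<exists>x. dist x y < 1 \<and> dist x (p i) < 1}"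
      have M0: "0 \<le> M i" for i using M[of i 0] norm_ge_zero order_trans by blast
      have "norm (G x) \<le> sum M ?J" if "dist x y < 1" for x
      proof (cases "\<exists>i. dist x (p i) < 1")
        case True
        then obtain i where i: "dist x (p i) < 1" by blast
        then have "norm (G x) \<le> M i" using inside M by (simp add: D'_def)
        also have "\<dots> \<le> sum M ?J"
          using i that M0 fin by (intro member_le_sum) auto
        finally show ?thesis .
      next
        case False
        then have "G x = 0" using outside by (simp add: not_less)
        then show ?thesis using M0 by (simp add: sum_nonneg)
      qed
      then show "\<exists>e>0. \<exists>B. \<forall>x. dist x y < e \<longrightarrow> norm (G x) \<le> B"
        using zero_less_one by blast
    qed
    fix K :: "'a set" assume K: "compact K" "connected K" "interior K \<noteq> {}"
    \<comment> \<open>The nonempty interior is used here: it makes \<open>K\<close> contain a point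
      of the dense sequence.\<close>
    obtain j where j: "d j \<in> interior K"
      using d[OF open_interior K(3), of 0] by blast
    obtain r where r: "K \<subseteq> ball (d j) r"
      using bounded_subset_ballD[OF compact_imp_bounded[OF K(1)]] by blast
    obtain n where n: "r \<le> real n" using real_arch_simple by blast
    define i where "i = prod_encode (j, n)"
    have "q i = d j" "R i = real (Suc n)" by (simp_all add: i_def q_def R_def)
    moreover have "ball (d j) r \<subseteq> ball (d j) (real (Suc n))"
      using n by (intro subset_ball) simp
    ultimately obtain x where x: "norm x < 1" "gradient_limits (D i) x = K"
      using D[of K i] K r j interior_subset[of K] compact_imp_closed by (metis subset_iff)
    have "gradient_limits G (p i + t i *\<^sub>R x) = (+) 0 ` gradient_limits (D i) x"
    proof (rule gradient_limits_affine)
      show "t i * (1 - norm x) > 0" using t(1) x by simp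
      fix y assume "dist y (p i + t i *\<^sub>R x) < t i * (1 - norm x)"
      moreover have "dist (p i + t i *\<^sub>R x) (p i) = t i * norm x"
        using t(1)[of i] by (simp add: dist_norm)
      ultimately have "dist y (p i) < 1"
        using dist_triangle[of y "p i" "p i + t i *\<^sub>R x"] t(2)[of i] by (simp add: algebra_simps)
      then show "G y = 0 + D i ((y - p i) /\<^sub>R t i)"
        using inside by (simp add: D'_def)
    qed (rule t)
    then show "\<exists>x. limiting_subdifferential F x = K"
      using x limiting_subdifferential_eq_gradient_limits[OF F] by auto
  qed
qed

theorem theorem3p16:
  shows "(\<exists>f :: real ^ 'n \<Rightarrow> real.
            (\<forall>x. f differentiable (at x)) \<and>
            locally_lipschitz f \<and>
            (\<forall>K. compact K \<and> connected K \<and> interior K \<noteq> {} \<longrightarrow>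
              (\<exists>x. limiting_subdifferential f x = K)))
       \<and> (\<forall>\<epsilon>::real. \<epsilon> > 0 \<longrightarrow>
           (\<exists>f :: real ^ 'n \<Rightarrow> real.
              (\<forall>x. f differentiable (at x)) \<and>
              locally_lipschitz f \<and>
              (\<forall>K. compact K \<and> connected K \<and> interior K \<noteq> {} \<longrightarrow>
                (\<exists>x. limiting_subdifferential f x = K)) \<and>
              bdd_above (range (\<lambda>x. \<bar>f x\<bar>)) \<and>
              (SUP x. \<bar>f x\<bar>) < \<epsilon>))"
proof -
  have bounded: "\<exists>f :: real ^ 'n \<Rightarrow> real. (\<forall>x. f differentiable (at x)) \<and> locally_lipschitz f \<and>
      (\<forall>K. compact K \<and> connected K \<and> interior K \<noteq> {} \<longrightarrow> (\<exists>x. limiting_subdifferential f x = K)) \<and>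
      bdd_above (range (\<lambda>x. \<bar>f x\<bar>)) \<and> (SUP x. \<bar>f x\<bar>) < \<epsilon>" if "\<epsilon> > 0" for \<epsilon>
  proof -
    \<comment> \<open>A pointwise bound by \<open>\<epsilon> / 2\<close> makes the supremum strictly
      smaller than \<open>\<epsilon>\<close>.\<close>
    obtain f :: "real ^ 'n \<Rightarrow> real"
      where f: "\<And>x. f differentiable (at x)" "locally_lipschitz f" "\<And>x. \<bar>f x\<bar> \<le> \<epsilon> / 2"
        "\<And>K. compact K \<Longrightarrow> connected K \<Longrightarrow> interior K \<noteq> {} \<Longrightarrow> \<exists>x. limiting_subdifferential f x = K"
      using ex_universal_subdifferential[of "\<epsilon> / 2"] \<open>\<epsilon> > 0\<close> by auto
    have "bdd_above (range (\<lambda>x. \<bar>f x\<bar>))"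
      using f(3) by (intro bdd_aboveI2)
    moreover have "(SUP x. \<bar>f x\<bar>) \<le> \<epsilon> / 2"
      using f(3) by (intro cSUP_least) auto
    ultimately show ?thesis
      using f that by (intro exI[of _ f]) auto
  qed
  from bounded[OF zero_less_one] bounded show ?thesis by blast
qed

end
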